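(* Let $\{V_j\}_{j\ge1}$ be a sequence of positive integers with $V_j=V_{j-1}+V_{j-2}$ for all $j\ge3$, let $n\ge1$ be an integer and $d\ge2$ an even integer, and assume $\gcd(V_1,V_2)=\gcd(V_n,F_d)=1$. Let $S=\langle V_n,V_{n+d},V_{n+2d},\ldots\rangle$. Then the Apéry set of $S$ with respect to $V_n$ is \[ \mathrm{Ap}(S,V_n)=\{s(x):1\le x\le V_n-1\}\cup\{0\}. \]
   Context: $F_j$ is the $j$-th Fibonacci number ($F_0=0,F_1=F_2=1$); note $F_d\mid F_{jd}$ for all $j\ge1$. $\langle A\rangle$ is the set of finite non-negative integer linear combinations of elements of $A$. For $a\in S$, the Apéry set is $\mathrm{Ap}(S,a)=\{m\in S: m-a\notin S\}$. The function $s$ (depending on $V$, $n$, $d$) is defined for a positive integer $x$ as follows: let $k\ge1$ be the integer with $F_{kd}/F_d\le x<F_{(k+1)d}/F_d$; define greedily $\lambda_k=\lfloor x/(F_{kd}/F_d)\rfloor$ and, for $j=k-1,k-2,\ldots,1$, $\lambda_j=\left\lfloor \big(x-\sum_{i=j+1}^k\lambda_iF_{id}/F_d\big)/(F_{jd}/F_d)\right\rfloor$; then $s(x)=\sum_{i=1}^k\lambda_iV_{n+id}$. *)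

theory Defs
  imports "HOL-Number_Theory.Fib"
begin

definition nonneg_combs :: "nat set \<Rightarrow> nat set"
  where "nonneg_combs A = {\<Sum>a\<in>B. c a * a | (B :: nat set) (c :: nat \<Rightarrow> nat). finite B \<and> B \<subseteq> A}"

(* The difference is taken in the integers: truncated subtraction on nat would turn
   m - a into 0, an element of S, whenever m < a. *)
definition Apery :: "nat set \<Rightarrow> nat \<Rightarrow> nat set"
  where "Apery S a = {m \<in> S. int m - int a \<notin> int ` S}"

(* The division is exact, see fib_dvd_fib_mult below. *)
definition fib_quot :: "nat \<Rightarrow> nat \<Rightarrow> nat"
  where "fib_quot d j = fib (j * d) div fib d"

definition top_index :: "nat \<Rightarrow> nat \<Rightarrow> nat"
  where "top_index d x = (THE k. 1 \<le> k \<and> fib_quot d k \<le> x \<and> x < fib_quot d (k + 1))"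

(* greedy_digit d k x j is the coefficient lambda_j of x for 1 <= j <= k; for j = k the
   inner sum is empty. The div on nat is the floor of the quotient, and the nat subtraction
   does not truncate, see greedy_partial_sum_le below. *)
function greedy_digit :: "nat \<Rightarrow> nat \<Rightarrow> nat \<Rightarrow> nat \<Rightarrow> nat"
  where "greedy_digit d k x j =
    (x - (\<Sum>i\<in>{j+1..k}. greedy_digit d k x i * fib_quot d i)) div fib_quot d j"
  by auto
termination
  by (relation "measure (\<lambda>(d, k, x, j). k + 1 - j)") auto

declare greedy_digit.simps [simp del]

definition s :: "(nat \<Rightarrow> nat) \<Rightarrow> nat \<Rightarrow> nat \<Rightarrow> nat \<Rightarrow> nat"
  where "s V n d x =
    (\<Sum>i = 1..top_index d x. greedy_digit d (top_index d x) x i * V (n + i * d))"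

lemma fib_dvd_fib_mult: "fib d dvd fib (j * d)"
  by (metis dvd_triv_right fib_gcd gcd_nat.absorb_iff1)

lemma greedy_partial_sum_le:
  "(\<Sum>i\<in>{j+1..k}. greedy_digit d k x i * fib_quot d i) \<le> x"
proof (induction "k - j" arbitrary: j)
  case 0
  then show ?case by simp
next
  case (Suc m)
  let ?R = "\<Sum>i\<in>{Suc j+1..k}. greedy_digit d k x i * fib_quot d i"
  have "?R \<le> x"
    using Suc.hyps(1)[of "Suc j"] Suc.hyps(2) by simp
  moreover have "greedy_digit d k x (Suc j) * fib_quot d (Suc j) \<le> x - ?R"
    by (subst greedy_digit.simps) simp
  moreover have "(\<Sum>i\<in>{j+1..k}. greedy_digit d k x i * fib_quot d i)
      = greedy_digit d k x (Suc j) * fib_quot d (Suc j) + ?R"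
    using Suc.hyps(2) by (subst sum.atLeast_Suc_atMost) auto
  ultimately show ?case by linarith
qed

lemma fib_less:
  assumes "2 \<le> m" "m < n"
  shows "fib m < fib n"
  using assms(2)
proof (induction n)
  case 0
  then show ?case by simp
next
  case (Suc n)
  have "fib (Suc n) = fib n + fib (n - 1)" "fib (n - 1) > 0"
    using Suc.prems assms(1) by (cases n, auto simp: fib_neq_0_nat)+
  then show ?case using Suc by (cases "m = n") auto
qed

lemma fib_quot_strict_mono:
  assumes "d \<ge> 2" "i < j"
  shows "fib_quot d i < fib_quot d j"
proof -
  have pos: "fib d > 0" using assms by (simp add: fib_neq_0_nat)
  have "fib (i * d) < fib (j * d)"
  proof (cases "i = 0")
    case True
    then show ?thesis using assms by (simp add: fib_neq_0_nat)
  next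
    case False
    have "i * d < j * d" "2 \<le> i * d"
      using assms False mult_le_mono[of 1 i 2 d] by auto
    then show ?thesis by (intro fib_less)
  qed
  then show ?thesis
    unfolding fib_quot_def using fib_dvd_fib_mult pos
    by (metis dvd_mult_div_cancel mult_less_cancel1)
qed

lemma top_index_unique:
  assumes "d \<ge> 2" "x \<ge> 1"
  shows "\<exists>!k. 1 \<le> k \<and> fib_quot d k \<le> x \<and> x < fib_quot d (k + 1)"
proof -
  have sm: "strict_mono (fib_quot d)"
    using fib_quot_strict_mono[OF assms(1)] by (simp add: strict_mono_def)
  have one: "fib_quot d 1 = 1"
    using assms by (simp add: fib_quot_def fib_neq_0_nat)
  define k where "k = (LEAST k. x < fib_quot d (k + 1))"
  have "\<exists>k. x < fib_quot d (k + 1)"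
    using strict_mono_imp_increasing[OF sm, of "x + 1"] by (metis Suc_eq_plus1 Suc_le_lessD)
  then have k: "x < fib_quot d (k + 1)" unfolding k_def by (rule LeastI_ex)
  have k1: "1 \<le> k" using k one assms(2) by (cases k) auto
  have "\<not> x < fib_quot d (k - 1 + 1)"
    using not_less_Least[of "k - 1" "\<lambda>k. x < fib_quot d (k + 1)"] k1 unfolding k_def by auto
  then have "fib_quot d k \<le> x" using k1 by simp
  moreover have "k' = k" if "fib_quot d k' \<le> x" "x < fib_quot d (k' + 1)" for k'
    using that k calculation strict_mono_less[OF sm]
    by (metis Suc_eq_plus1 less_Suc_eq_le order.antisym order.strict_trans1)
  ultimately show ?thesis using k k1 by blast
qed

end

theory Submission
  imports Defs Complex_Main
begin

text \<open>
  Put \<open>q j = fib (j * d) div fib d\<close> and \<open>W j = V (n + j * d)\<close>. As \<open>d\<close> is even, both satisfy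
  \<open>u (j + 2) + u j = L * u (j + 1)\<close> with \<open>L = fib (d + 1) + fib (d - 1)\<close>, so
  \<open>W j = q j * W 1 - q (j - 1) * W 0\<close>. If \<open>b\<close> is the root of \<open>b\<^sup>2 + 1 = L * b\<close> in \<open>(0, 1)\<close>, then
  \<open>b * q j = q (j - 1) + b ^ j\<close>. Hence a sum of \<open>W j\<close>'s with coefficients \<open>\<lambda> j\<close> and
  \<open>x = \<Sum> \<lambda> j * q j\<close> equals \<open>x * W 1 - y * W 0\<close> with \<open>b * x - y = \<Sum> \<lambda> j * b ^ j \<ge> 0\<close>, and for the
  greedy digits this last sum is less than 1. So \<open>s x = x * W 1 - \<lfloor>b * x\<rfloor> * W 0\<close>, which is the least
  value over all representations of \<open>x\<close>; since \<open>b < 1\<close> and \<open>W 0 \<le> W 1\<close>, replacing \<open>x\<close> by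
  \<open>x mod W 0\<close> does not increase it. As \<open>W 1\<close> is a unit modulo \<open>W 0\<close>, the numbers \<open>s x\<close> with
  \<open>1 \<le> x < W 0\<close>, together with 0, are the minimal elements of \<open>S\<close> in the residue classes modulo \<open>W 0\<close>.
\<close>

section \<open>Fibonacci-type sequences along steps of even length\<close>

lemma fib_like_add:
  fixes U :: "nat \<Rightarrow> nat"
  assumes "\<And>j. U (Suc (Suc j)) = U (Suc j) + U j"
  shows "U (j + Suc k) = fib (Suc k) * U (Suc j) + fib k * U j"
proof -
  have "U (j + Suc k) = fib (Suc k) * U (Suc j) + fib k * U j
    \<and> U (j + Suc (Suc k)) = fib (Suc (Suc k)) * U (Suc j) + fib (Suc k) * U j"
    by (induction k) (simp_all add: assms algebra_simps)
  then show ?thesis by blast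
qed

lemma fib_Cassini_even:
  assumes "even d" "d \<ge> 2"
  shows "fib (Suc d) * fib (d - 1) = fib d * fib d + 1"
proof -
  obtain m where m: "d = Suc m" "odd m" using assms by (cases d) auto
  have "int (fib (Suc (Suc m)) * fib m) = int (fib (Suc m) * fib (Suc m) + 1)"
    using fib_Cassini_int[of m] m(2) by (simp add: power2_eq_square)
  then show ?thesis unfolding m(1) of_nat_eq_iff by simp
qed

text \<open>Expansion by the addition formula leaves \<open>fib d * fib d + 1\<close> as the factor
  of \<open>U j\<close>. Cassini's identity, whose sign is fixed by \<open>d\<close> being even,
  turns it into \<open>fib (Suc d) * fib (d - 1)\<close>, and \<open>U (j + d)\<close> factors
  out.\<close>

lemma fib_like_double_step:
  fixes U :: "nat \<Rightarrow> nat"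
  assumes U: "\<And>j. U (Suc (Suc j)) = U (Suc j) + U j" and d: "even d" "d \<ge> 2"
  shows "U (j + d + d) + U j = (fib (Suc d) + fib (d - 1)) * U (j + d)"
proof -
  obtain e where e: "d = Suc e" using d by (cases d) auto
  have step: "U (i + d) = fib d * U (Suc i) + fib (d - 1) * U i" for i
    using fib_like_add[of U i e, OF U] by (simp add: e)
  have "U (Suc (j + d)) = fib (Suc d) * U (Suc j) + fib d * U j"
    using fib_like_add[of U j d, OF U] by simp
  then have "U (j + d + d) + U j
      = fib d * fib (Suc d) * U (Suc j) + (fib d * fib d + 1) * U j + fib (d - 1) * U (j + d)"
    using step[of "j + d"] by (simp add: algebra_simps)
  also have "\<dots> = fib (Suc d) * (fib d * U (Suc j) + fib (d - 1) * U j) + fib (d - 1) * U (j + d)"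
    unfolding fib_Cassini_even[OF d, symmetric] by (simp add: algebra_simps)
  also have "\<dots> = (fib (Suc d) + fib (d - 1)) * U (j + d)"
    by (simp only: step[symmetric] distrib_right)
  finally show ?thesis .
qed

lemma fib_like_coprime:
  fixes U :: "nat \<Rightarrow> nat"
  assumes "\<And>j. U (Suc (Suc j)) = U (Suc j) + U j" "coprime (U 0) (U (Suc 0))"
  shows "coprime (U j) (U (Suc j))"
proof (induction j)
  case (Suc j)
  then show ?case unfolding assms(1) by (simp add: coprime_commute gcd.commute coprime_iff_gcd_eq_1)
qed (use assms in simp)

lemma fib_quot_0 [simp]: "fib_quot d 0 = 0"
  by (simp add: fib_quot_def)

lemma fib_quot_1 [simp]: "d > 0 \<Longrightarrow> fib_quot d (Suc 0) = 1"
  by (simp add: fib_quot_def fib_neq_0_nat)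

lemma fib_quot_mult: "fib_quot d j * fib d = fib (j * d)"
  by (simp add: fib_quot_def fib_dvd_fib_mult)

lemma fib_quot_rec:
  assumes "even d" "d \<ge> 2"
  shows "fib_quot d (Suc (Suc j)) + fib_quot d j
    = (fib (Suc d) + fib (d - 1)) * fib_quot d (Suc j)"
proof -
  have "fib (j * d + d + d) + fib (j * d) = (fib (Suc d) + fib (d - 1)) * fib (j * d + d)"
    by (rule fib_like_double_step) (use assms in auto)
  then have "(fib_quot d (Suc (Suc j)) + fib_quot d j) * fib d
      = ((fib (Suc d) + fib (d - 1)) * fib_quot d (Suc j)) * fib d"
    by (simp add: fib_quot_mult distrib_right mult.assoc add_ac)
  moreover have "fib d > 0" using assms by (intro fib_neq_0_nat) simp
  ultimately show ?thesis by (metis mult_right_cancel less_not_refl)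
qed

text \<open>Both sides obey the same second-order recurrence in \<open>j\<close> and agree at
  \<open>j = 0\<close> and \<open>j = 1\<close>.\<close>

lemma fib_like_fib_quot:
  fixes U :: "nat \<Rightarrow> nat"
  assumes U: "\<And>j. U (Suc (Suc j)) = U (Suc j) + U j" and d: "even d" "d \<ge> 2"
  shows "int (U (Suc j * d)) = int (fib_quot d (Suc j)) * int (U d) - int (fib_quot d j) * int (U 0)"
proof (induction j rule: induct_nat_012)
  case 0
  show ?case using d by simp
next
  case 1
  show ?case
    using fib_like_double_step[of U d 0, OF U d] fib_quot_rec[OF d, of 0] d
    by (simp add: algebra_simps flip: of_nat_mult of_nat_add)
next
  case (ge2 j)
  define L where "L = int (fib (Suc d) + fib (d - 1))"
  have "int (U (Suc j * d + d + d)) + int (U (Suc j * d)) = L * int (U (Suc j * d + d))"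
    using fib_like_double_step[of U d "Suc j * d", OF U d]
    unfolding L_def by (simp flip: of_nat_mult of_nat_add)
  moreover have q: "int (fib_quot d (Suc (Suc i))) = L * int (fib_quot d (Suc i)) - int (fib_quot d i)" for i
    using fib_quot_rec[OF d, of i] unfolding L_def
    by (simp add: algebra_simps flip: of_nat_mult of_nat_add)
  moreover have "Suc (Suc (Suc j)) * d = Suc j * d + d + d" "Suc (Suc j) * d = Suc j * d + d"
    by simp_all
  ultimately have "int (U (Suc (Suc (Suc j)) * d)) = L * int (U (Suc (Suc j) * d)) - int (U (Suc j * d))"
    by (simp only: add_diff_cancel_right' eq_diff_eq)
  then show ?case unfolding ge2 q[of "Suc j"] q[of j] by (simp add: algebra_simps)
qed

section \<open>The root \<open>b\<close> and bounds for digit sums\<close>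

text \<open>The witness is the smaller root of \<open>t\<^sup>2 - L * t + 1\<close>; the bound
  \<open>(L - 2)\<^sup>2 < L\<^sup>2 - 4\<close> places it below 1.\<close>

lemma recip_pair_root:
  fixes L :: real
  assumes "L > 2"
  obtains b where "0 < b" "b < 1" "b\<^sup>2 + 1 = L * b"
proof
  define r where "r = sqrt (L\<^sup>2 - 4)"
  have "(L - 2)\<^sup>2 < L\<^sup>2 - 4" using assms by (simp add: power2_eq_square algebra_simps)
  then have "L - 2 < r" unfolding r_def by (rule real_less_rsqrt)
  moreover have "r < L" unfolding r_def using assms by (intro real_less_lsqrt) simp_all
  moreover have "r\<^sup>2 = L\<^sup>2 - 4" using \<open>(L - 2)\<^sup>2 < L\<^sup>2 - 4\<close> unfolding r_def
    by (smt (verit) real_sqrt_pow2 zero_le_power2)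
  ultimately show "0 < (L - r) / 2" "(L - r) / 2 < 1" "((L - r) / 2)\<^sup>2 + 1 = L * ((L - r) / 2)"
    by (simp_all add: power2_eq_square field_simps)
qed

text \<open>The powers of \<open>b\<close> obey the recurrence of \<open>fib_quot d\<close>, so
  comparing \<open>j = 0\<close> and \<open>j = 1\<close> suffices.\<close>

lemma fib_quot_root:
  fixes b :: real
  assumes d: "even d" "d \<ge> 2" and b: "b\<^sup>2 + 1 = real (fib (Suc d) + fib (d - 1)) * b"
  shows "b * real (fib_quot d (Suc j)) = real (fib_quot d j) + b ^ Suc j"
proof (induction j rule: induct_nat_012)
  case 0
  show ?case using d by simp
next
  case 1
  show ?case using b fib_quot_rec[OF d, of 0] d by (simp add: power2_eq_square algebra_simps)
next
  case (ge2 j)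
  define L where "L = real (fib (Suc d) + fib (d - 1))"
  have q: "real (fib_quot d (Suc (Suc i))) = L * real (fib_quot d (Suc i)) - real (fib_quot d i)" for i
    using fib_quot_rec[OF d, of i] unfolding L_def
    by (simp add: algebra_simps flip: of_nat_mult of_nat_add)
  have "b * real (fib_quot d (Suc (Suc (Suc j))))
      = L * (b * real (fib_quot d (Suc (Suc j)))) - b * real (fib_quot d (Suc j))"
    unfolding q[of "Suc j"] by (simp add: algebra_simps)
  also have "\<dots> = (L * real (fib_quot d (Suc j)) - real (fib_quot d j)) + (L * b - 1) * b ^ Suc j"
    unfolding ge2 by (simp add: algebra_simps)
  also have "\<dots> = real (fib_quot d (Suc (Suc j))) + b ^ Suc (Suc (Suc j))"
    using b unfolding q L_def[symmetric] by (simp add: power2_eq_square flip: b)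
  finally show ?case .
qed

text \<open>The variable \<open>t\<close> strengthens the induction: when the leading digit is the maximal
  one, the remaining sum is smaller by \<open>q j\<close> than the general bound, which is the case
  \<open>t = 1\<close> of the induction hypothesis.\<close>
lemma digit_sum_bound:
  fixes b :: real and q l :: "nat \<Rightarrow> nat"
  assumes b: "0 < b" "b < 1" "b\<^sup>2 + 1 = real L * b"
    and q: "q 0 = 0" "q (Suc 0) = 1" "\<And>j. q (Suc (Suc j)) + q j = L * q (Suc j)"
    and "(\<Sum>i = 1..Suc j. l i * q i) + t * q (Suc j) < q (Suc (Suc j))"
    and "\<And>i. i \<le> j \<Longrightarrow> (\<Sum>i = 1..i. l i * q i) < q (Suc i)"
  shows "(\<Sum>i = 1..Suc j. real (l i) * b ^ i) + real t * b ^ Suc j \<le> 1 - (1 - b) * b ^ Suc j"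
  using assms(7,8)
proof (induction j arbitrary: t)
  case 0
  have "l 1 + t + 1 \<le> L" using 0(1) q(2) q(3)[of 0] q(1) by simp
  then have "real (l 1 + t + 1) * b \<le> real L * b" using b by (intro mult_right_mono) (simp_all del: of_nat_add)
  then show ?case using b by (simp add: power2_eq_square algebra_simps)
next
  case (Suc j)
  let ?R = "\<Sum>i = 1..Suc j. l i * q i" and ?e = "\<Sum>i = 1..Suc j. real (l i) * b ^ i"
  define c where "c = l (Suc (Suc j)) + t"
  have R: "?R + c * q (Suc (Suc j)) < q (Suc (Suc (Suc j)))"
    using Suc.prems(1) by (simp add: c_def algebra_simps)
  have below: "?R < q (Suc (Suc j))" using Suc.prems(2)[of "Suc j"] by simp
  have top: "q (Suc (Suc (Suc j))) + q (Suc j) = L * q (Suc (Suc j))" by (rule q(3))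
  have "c * q (Suc (Suc j)) < L * q (Suc (Suc j))" using R top by linarith
  then have "c < L" by simp
  have goal: "?e + real c * b ^ Suc (Suc j) \<le> 1 - (1 - b) * b ^ Suc (Suc j)"
  proof (cases "c + 2 \<le> L")
    \<comment> \<open>For \<open>c = L - 2\<close> the bound on \<open>?e\<close> yields exactly the
      claimed bound, because \<open>L * b = b\<^sup>2 + 1\<close>; a smaller \<open>c\<close> leaves
      slack.\<close>
    case True
    have "?e \<le> 1 - (1 - b) * b ^ Suc j"
      using Suc.IH[of 0] below Suc.prems(2) by simp
    moreover have "real (c + 2) * b ^ Suc (Suc j) \<le> real L * b ^ Suc (Suc j)"
      using True b by (intro mult_right_mono) (simp_all del: of_nat_add)
    moreover have "real L * b ^ Suc (Suc j) = (b\<^sup>2 + 1) * b ^ Suc j"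
      unfolding b(3) by simp
    ultimately show ?thesis by (simp add: power2_eq_square algebra_simps)
  next
    case False
    then have L: "L = Suc c" using \<open>c < L\<close> by simp
    have "?R + 1 * q (Suc j) < q (Suc (Suc j))" using R top by (simp add: L)
    then have "?e + b ^ Suc j \<le> 1 - (1 - b) * b ^ Suc j"
      using Suc.IH[of 1] Suc.prems(2) by simp
    moreover have "real c * b ^ Suc (Suc j) = (b\<^sup>2 + 1) * b ^ Suc j - b ^ Suc (Suc j)"
      unfolding b(3) by (simp add: L algebra_simps)
    moreover have "b ^ Suc (Suc j) \<le> b ^ Suc j" using b by (intro power_decreasing) auto
    ultimately show ?thesis by (simp add: power2_eq_square algebra_simps)
  qed
  then show ?case by (simp add: c_def algebra_simps)
qed

section \<open>Greedy digits and the closed form of \<open>s\<close>\<close>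

text \<open>For \<open>j < k\<close>, what is left after choosing the digits above \<open>j\<close>
  is a remainder modulo \<open>fib_quot d (Suc j)\<close>, hence smaller than it. At
  \<open>j = 0\<close> the modulus is 1, so nothing is left. The second bound is what
  \<open>digit_sum_bound\<close> asks of the digits.\<close>

lemma greedy_partial_sums:
  fixes d k x :: nat
  defines "l \<equiv> greedy_digit d k x"
  assumes d: "d \<ge> 2" and k: "1 \<le> k" "x < fib_quot d (Suc k)"
  shows "(\<Sum>i = 1..k. l i * fib_quot d i) = x"
    and "j \<le> k \<Longrightarrow> (\<Sum>i = 1..j. l i * fib_quot d i) < fib_quot d (Suc j)"
proof -
  define T where "T j = (\<Sum>i = j+1..k. l i * fib_quot d i)" for j
  have T_le: "T j \<le> x" for j
    unfolding T_def l_def by (rule greedy_partial_sum_le)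
  have T_step: "x - T j = (x - T (Suc j)) mod fib_quot d (Suc j)" if "j < k" for j
  proof -
    have "T j = l (Suc j) * fib_quot d (Suc j) + T (Suc j)"
      unfolding T_def using that by (subst sum.atLeast_Suc_atMost) auto
    moreover have "l (Suc j) = (x - T (Suc j)) div fib_quot d (Suc j)"
      unfolding T_def l_def by (subst greedy_digit.simps) simp
    ultimately show ?thesis by (simp add: minus_div_mult_eq_mod[symmetric])
  qed
  have rem_less: "x - T j < fib_quot d (Suc j)" if "j \<le> k" for j
  proof (cases "j = k")
    case True
    then show ?thesis using k by (simp add: T_def)
  next
    case False
    have "0 < fib_quot d (Suc j)" using fib_quot_strict_mono[OF d, of 0 "Suc j"] by simp
    then show ?thesis using T_step[of j] that False by simp
  qed
  have "x - T 0 < 1" using rem_less[of 0] d by simp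
  then have T0: "T 0 = x" using T_le[of 0] by simp
  then show "(\<Sum>i = 1..k. l i * fib_quot d i) = x" by (simp add: T_def)
  show "(\<Sum>i = 1..j. l i * fib_quot d i) < fib_quot d (Suc j)" if "j \<le> k"
  proof -
    have "T 0 = (\<Sum>i = 1..j. l i * fib_quot d i) + T j"
      unfolding T_def using that sum.ub_add_nat[of 1 j _ "k - j"] by simp
    then show ?thesis using rem_less[OF that] T0 by linarith
  qed
qed

lemma s_eq:
  fixes V :: "nat \<Rightarrow> nat" and b :: real
  assumes V: "\<And>j. V (n + Suc (Suc j)) = V (n + Suc j) + V (n + j)"
    and d: "even d" "d \<ge> 2" and x: "x \<ge> 1"
    and b: "0 < b" "b < 1" "b\<^sup>2 + 1 = real (fib (Suc d) + fib (d - 1)) * b"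
  shows "int (s V n d x) = int x * int (V (n + d)) - \<lfloor>b * real x\<rfloor> * int (V n)"
proof -
  define k where "k = top_index d x"
  define l where "l = greedy_digit d k x"
  \<comment> \<open>\<open>y\<close> collects the coefficient of \<open>V n\<close>;
    \<open>e\<close> turns out to be the fractional part of \<open>b * x\<close>.\<close>
  define y where "y = (\<Sum>i = 1..k. int (l i) * int (fib_quot d (i - 1)))"
  define e where "e = (\<Sum>i = 1..k. real (l i) * b ^ i)"
  have k: "1 \<le> k" "x < fib_quot d (Suc k)"
    using theI'[OF top_index_unique[OF d(2) x]] unfolding k_def top_index_def by simp_all
  note sums = greedy_partial_sums[OF d(2) k, folded l_def]
  have W: "int (V (n + i * d)) = int (fib_quot d i) * int (V (n + d)) - int (fib_quot d (i - 1)) * int (V n)"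
    if "1 \<le> i" for i
    using fib_like_fib_quot[of "\<lambda>j. V (n + j)" d "i - 1"] V d that by simp
  have "int (s V n d x) = (\<Sum>i = 1..k. int (l i) * int (V (n + i * d)))"
    by (simp add: s_def k_def l_def)
  also have "\<dots> = (\<Sum>i = 1..k. int (l i * fib_quot d i) * int (V (n + d))
      - int (l i) * int (fib_quot d (i - 1)) * int (V n))"
    by (intro sum.cong) (simp_all add: W algebra_simps)
  also have "\<dots> = int (\<Sum>i = 1..k. l i * fib_quot d i) * int (V (n + d)) - y * int (V n)"
    by (simp add: sum_subtractf sum_distrib_right y_def)
  finally have s: "int (s V n d x) = int x * int (V (n + d)) - y * int (V n)"
    unfolding sums(1) .
  have "b * real x = b * real (\<Sum>i = 1..k. l i * fib_quot d i)" unfolding sums(1) ..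
  also have "\<dots> = (\<Sum>i = 1..k. real (l i) * (b * real (fib_quot d i)))"
    by (simp add: sum_distrib_left algebra_simps)
  also have "\<dots> = (\<Sum>i = 1..k. real (l i) * (real (fib_quot d (i - 1)) + b ^ i))"
  proof (intro sum.cong refl)
    fix i assume "i \<in> {1..k}"
    then show "real (l i) * (b * real (fib_quot d i)) = real (l i) * (real (fib_quot d (i - 1)) + b ^ i)"
      using fib_quot_root[OF d b(3), of "i - 1"] by simp
  qed
  also have "\<dots> = real_of_int y + e"
    by (simp add: y_def e_def distrib_left sum.distrib)
  finally have bx: "b * real x = real_of_int y + e" .
  have "0 \<le> e" unfolding e_def using b by (intro sum_nonneg) simp
  moreover have "e < 1"
  proof -
    have Sk: "Suc (k - 1) = k" using k(1) by simp
    have "(\<Sum>i = 1..Suc (k - 1). real (l i) * b ^ i) + real 0 * b ^ Suc (k - 1)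
        \<le> 1 - (1 - b) * b ^ Suc (k - 1)"
    proof (rule digit_sum_bound[OF b])
      show "(\<Sum>i = 1..Suc (k - 1). l i * fib_quot d i) + 0 * fib_quot d (Suc (k - 1))
          < fib_quot d (Suc (Suc (k - 1)))"
        using k sums(1) by simp
    qed (use d sums(2) k fib_quot_rec[OF d] in simp_all)
    then have "e \<le> 1 - (1 - b) * b ^ k" unfolding Sk by (simp add: e_def)
    moreover have "0 < (1 - b) * b ^ k" using b by simp
    ultimately show ?thesis by linarith
  qed
  ultimately have "\<lfloor>b * real x\<rfloor> = y" using bx by (intro floor_unique) auto
  then show ?thesis using s by simp
qed

section \<open>Closure and induction for generated monoids\<close>

lemma nonneg_combs_0: "0 \<in> nonneg_combs A"
  unfolding nonneg_combs_def by (intro CollectI exI[of _ "{}"]) simp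

lemma nonneg_combs_mult: "a \<in> A \<Longrightarrow> c * a \<in> nonneg_combs A"
  unfolding nonneg_combs_def by (intro CollectI exI[of _ "{a}"] exI[of _ "\<lambda>_. c"]) simp

lemma nonneg_combs_add:
  assumes "u \<in> nonneg_combs A" "v \<in> nonneg_combs A"
  shows "u + v \<in> nonneg_combs A"
proof -
  obtain B c where B: "u = (\<Sum>a\<in>B. c a * a)" "finite B" "B \<subseteq> A"
    using assms(1) unfolding nonneg_combs_def by blast
  obtain B' c' where B': "v = (\<Sum>a\<in>B'. c' a * a)" "finite B'" "B' \<subseteq> A"
    using assms(2) unfolding nonneg_combs_def by blast
  define f where "f a = (if a \<in> B then c a else 0) + (if a \<in> B' then c' a else 0)" for a
  have "(\<Sum>a\<in>B \<union> B'. f a * a)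
      = (\<Sum>a\<in>B \<union> B'. if a \<in> B then c a * a else 0) + (\<Sum>a\<in>B \<union> B'. if a \<in> B' then c' a * a else 0)"
    unfolding sum.distrib[symmetric] by (intro sum.cong) (auto simp: f_def algebra_simps)
  also have "\<dots> = u + v"
    using B B' by (simp add: sum.If_cases Int_absorb1 Int_absorb2 Un_Int_distrib2)
  finally show ?thesis
    unfolding nonneg_combs_def using B B' by (intro CollectI exI[of _ "B \<union> B'"] exI[of _ f]) auto
qed

lemma nonneg_combs_sum:
  "(\<And>i. i \<in> I \<Longrightarrow> f i \<in> nonneg_combs A) \<Longrightarrow> sum f I \<in> nonneg_combs A"
  by (induction I rule: infinite_finite_induct) (auto simp: nonneg_combs_0 nonneg_combs_add)

lemma nonneg_combs_induct [consumes 1, case_names zero add]: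
  assumes "m \<in> nonneg_combs A" "P 0" "\<And>a v. a \<in> A \<Longrightarrow> P v \<Longrightarrow> P (a + v)"
  shows "P m"
proof -
  obtain B c where B: "m = (\<Sum>a\<in>B. c a * a)" "finite B" "B \<subseteq> A"
    using assms(1) unfolding nonneg_combs_def by blast
  have mult: "P (k * a + v)" if "a \<in> A" "P v" for k a v
    by (induction k) (use that assms(3) in \<open>auto simp: add.assoc\<close>)
  show ?thesis unfolding B(1) using B(2,3)
    by (induction B rule: finite_induct) (auto simp: assms(2) mult)
qed

section \<open>Minimal elements of the residue classes\<close>

theorem theorem3p3p3:
  fixes V :: "nat \<Rightarrow> nat" and n d :: nat
  assumes "\<And>j. j \<ge> 1 \<Longrightarrow> V j > 0"
    and "\<And>j. j \<ge> 3 \<Longrightarrow> V j = V (j - 1) + V (j - 2)"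
    and "n \<ge> 1" and "d \<ge> 2" and "even d"
    and "gcd (V 1) (V 2) = 1" and "gcd (V n) (fib d) = 1"
  shows "Apery (nonneg_combs {V (n + i * d) | i. True}) (V n) =
    {s V n d x | x. 1 \<le> x \<and> x \<le> V n - 1} \<union> {0}"
proof -
  define S where "S = nonneg_combs {V (n + i * d) | i. True}"
  define w0 w1 where "w0 = V n" and "w1 = V (n + d)"
  \<comment> \<open>\<open>top_index d 0\<close> is unspecified, so the class of 0 gets its minimal
    element 0 by hand.\<close>
  define f where "f x = (if x = 0 then 0 else s V n d x)" for x
  note d = \<open>even d\<close> \<open>d \<ge> 2\<close>
  have V1: "V (Suc (Suc (Suc j))) = V (Suc (Suc j)) + V (Suc j)" for j
    using assms(2)[of "Suc (Suc (Suc j))"] by simp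
  have V: "V (n + Suc (Suc j)) = V (n + Suc j) + V (n + j)" for j
    using assms(2)[of "n + Suc (Suc j)"] \<open>n \<ge> 1\<close> by simp
  have w0: "w0 > 0" using assms(1,3) by (simp add: w0_def)
  have w1: "w1 = fib d * V (Suc n) + fib (d - 1) * w0"
    using fib_like_add[of "\<lambda>j. V (n + j)" 0 "d - 1"] V d by (simp add: w0_def w1_def)
  have "w0 \<le> w1"
    using d fib_neq_0_nat[of "d - 1"] unfolding w1 by (simp add: Suc_le_eq trans_le_add2)
  \<comment> \<open>Modulo \<open>w0\<close>, \<open>w1\<close> is \<open>fib d * V (Suc n)\<close>.
    Coprimality of consecutive terms propagates from \<open>V 1\<close> and \<open>V 2\<close>; the
    factor \<open>fib d\<close> is covered by hypothesis.\<close>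
  have "coprime w0 (V (Suc n))"
    using fib_like_coprime[of "\<lambda>j. V (Suc j)" "n - 1"] V1 assms(3,6)
    by (simp add: w0_def coprime_iff_gcd_eq_1 numeral_2_eq_2)
  then have "coprime w0 (fib d * V (Suc n))"
    unfolding coprime_mult_right_iff using coprime_iff_gcd_eq_1 assms(7) w0_def by blast
  then have "coprime w0 w1"
    unfolding w1 coprime_iff_gcd_eq_1
    by (simp only: add.commute[of "fib d * V (Suc n)"] gcd_add_mult)
  then have cop: "coprime (int w0) (int w1)" by simp
  have "fib 2 < fib (Suc d)" using d by (intro fib_less) auto
  moreover have "fib (d - 1) > 0" using d by (intro fib_neq_0_nat) auto
  ultimately have "real (fib (Suc d) + fib (d - 1)) > 2" by (simp add: numeral_2_eq_2)
  then obtain b where b: "0 < b" "b < 1" "b\<^sup>2 + 1 = real (fib (Suc d) + fib (d - 1)) * b"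
    by (rule recip_pair_root)
  have f: "int (f x) = int x * int w1 - \<lfloor>b * real x\<rfloor> * int w0" for x
    using s_eq[OF V d _ b, of x] by (simp add: f_def w0_def w1_def)
  have gen: "V (n + i * d) \<in> {V (n + i * d) | i. True}" for i by blast
  have f_S: "f x \<in> S" for x
    unfolding f_def S_def s_def using gen
    by (auto intro!: nonneg_combs_sum nonneg_combs_mult nonneg_combs_0)
  have w0_S: "z * w0 \<in> S" for z
    unfolding S_def w0_def using gen[of 0] by (intro nonneg_combs_mult) simp
  \<comment> \<open>Equation and inequality are both additive, so only generators need checking;
    \<open>w0\<close> itself has \<open>x = 0\<close> and \<open>y = -1\<close>.\<close>
  have rep: "\<exists>x y. int m = int x * int w1 - y * int w0 \<and> real_of_int y \<le> b * real x"
    if "m \<in> S" for m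
    using that unfolding S_def
  proof (induction rule: nonneg_combs_induct)
    case zero
    show ?case by (intro exI[of _ 0]) simp
  next
    case (add a v)
    obtain i where i: "a = V (n + i * d)" using add(1) by blast
    have "\<exists>x y. int a = int x * int w1 - y * int w0 \<and> real_of_int y \<le> b * real x"
    proof (cases i)
      case 0
      then show ?thesis by (intro exI[of _ 0] exI[of _ "-1"]) (simp add: i w0_def)
    next
      case (Suc j)
      have "int a = int (fib_quot d i) * int w1 - int (fib_quot d j) * int w0"
        using fib_like_fib_quot[of "\<lambda>j. V (n + j)" d j] V d by (simp add: i Suc w0_def w1_def)
      moreover have "real_of_int (int (fib_quot d j)) \<le> b * real (fib_quot d i)"
        using fib_quot_root[OF d b(3), of j] b(1) unfolding Suc by simp
      ultimately show ?thesis by blast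
    qed
    then obtain x y where "int a = int x * int w1 - y * int w0" "real_of_int y \<le> b * real x" by blast
    moreover obtain x' y' where "int v = int x' * int w1 - y' * int w0" "real_of_int y' \<le> b * real x'"
      using add(2) by blast
    ultimately show ?case
      by (intro exI[of _ "x + x'"] exI[of _ "y + y'"]) (simp add: algebra_simps)
  qed
  have above: "\<exists>x z. x < w0 \<and> m = f x + z * w0" if mS: "m \<in> S" for m
  proof -
    obtain x y where m: "int m = int x * int w1 - y * int w0" and y: "real_of_int y \<le> b * real x"
      using rep[OF mS] by blast
    \<comment> \<open>Reducing \<open>x\<close> to \<open>r\<close> changes \<open>y\<close> to
      \<open>y - p * w1\<close>. The inequality survives because
      \<open>b * p * w0 \<le> p * w0 \<le> p * w1\<close>; the gap to the floor is the multiple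
      \<open>z\<close> of \<open>w0\<close>.\<close>
    define r p where "r = x mod w0" and "p = x div w0"
    have x: "x = r + p * w0" by (simp add: r_def p_def)
    have "b * real (p * w0) \<le> 1 * real (p * w0)" using b by (intro mult_right_mono) auto
    then have "b * real x \<le> b * real r + real (p * w0)" by (simp add: x distrib_left)
    moreover have "p * w0 \<le> p * w1" using \<open>w0 \<le> w1\<close> by simp
    ultimately have "real_of_int (y - int (p * w1)) \<le> b * real r"
      using y by (smt (verit) of_int_diff of_int_of_nat_eq of_nat_le_iff)
    then have "y - int (p * w1) \<le> \<lfloor>b * real r\<rfloor>" by (simp only: le_floor_iff)
    then obtain z where z: "\<lfloor>b * real r\<rfloor> - (y - int (p * w1)) = int z"
      by (metis diff_ge_0_iff_ge nonneg_int_cases)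
    have "int m = int (f r) + (\<lfloor>b * real r\<rfloor> - (y - int (p * w1))) * int w0"
      unfolding m f x by (simp add: algebra_simps)
    then have "int m = int (f r + z * w0)" unfolding z by simp
    then have "m = f r + z * w0" by (simp only: of_nat_eq_iff)
    moreover have "r < w0" using w0 by (simp add: r_def)
    ultimately show ?thesis by blast
  qed
  \<comment> \<open>\<open>f x\<close> is congruent to \<open>x * w1\<close> modulo
    \<open>w0\<close>, and \<open>w1\<close> can be cancelled.\<close>
  have inj: "x = x'" if "x < w0" "x' < w0" "int (f x) = int (f x') + z * int w0" for x x' z
  proof -
    have "(int x - int x') * int w1 = (\<lfloor>b * real x\<rfloor> - \<lfloor>b * real x'\<rfloor> + z) * int w0"
      using that(3) unfolding f by (simp add: algebra_simps)
    then have "int w0 dvd (int x - int x') * int w1" by simp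
    then have "int w0 dvd int x - int x'" using cop coprime_dvd_mult_left_iff by blast
    then have "int x mod int w0 = int x' mod int w0" by (simp only: mod_eq_dvd_iff)
    then show ?thesis using that(1,2) by simp
  qed
  have "Apery S w0 = f ` {..<w0}"
  proof (intro subset_antisym subsetI)
    fix m assume m: "m \<in> Apery S w0"
    then obtain x z where xz: "x < w0" "m = f x + z * w0" using above unfolding Apery_def by blast
    have "z = 0"
    proof (rule ccontr)
      assume "z \<noteq> 0"
      then have "int m - int w0 = int (f x + (z - 1) * w0)"
        by (cases z) (simp_all add: xz)
      moreover have "f x + (z - 1) * w0 \<in> S"
        using f_S w0_S unfolding S_def by (intro nonneg_combs_add)
      ultimately show False using m unfolding Apery_def by blast
    qed
    then show "m \<in> f ` {..<w0}" using xz by simp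
  next
    fix m assume "m \<in> f ` {..<w0}"
    then obtain x where x: "x < w0" "m = f x" by blast
    have "int m - int w0 \<notin> int ` S"
    proof
      assume "int m - int w0 \<in> int ` S"
      then obtain u where u: "u \<in> S" "int m - int w0 = int u" by blast
      obtain x' z where x': "x' < w0" "u = f x' + z * w0" using above[OF u(1)] by blast
      \<comment> \<open>\<open>f x\<close> and \<open>f x'\<close> lie in one class, so
        \<open>x = x'\<close>; then the positive multiple \<open>z + 1\<close> of \<open>w0\<close>
        would vanish.\<close>
      have eq: "int (f x) = int (f x') + (int z + 1) * int w0"
        using u(2) x' x by (simp add: algebra_simps)
      then have "x = x'" using inj x(1) x'(1) by blast
      then have "(int z + 1) * int w0 = 0" using eq by simp
      then show False using w0 by simp
    qed
    then show "m \<in> Apery S w0" using f_S x(2) unfolding Apery_def by simp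
  qed
  also have "\<dots> = {s V n d x | x. 1 \<le> x \<and> x \<le> w0 - 1} \<union> {0}"
    using w0 by (auto simp: f_def image_iff Suc_le_eq)
  finally show ?thesis unfolding S_def w0_def .
qed

end
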